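(* Let the graph be connected, let $0<a<1$, let $z\in\mathbb{R}^n$ with $z_{\mathcal M^\perp}\neq 0$, and for $\alpha\in\mathbb{R}$ let $z(\alpha)=z-\alpha e$ and $h(\alpha)=\sigma_a(z(\alpha))$, where $\sigma_a(x)=\max\{x,ax\}$ is leaky ReLU applied entrywise. Then (1) $\min_\alpha s(h(\alpha))=0$, and (2) $\sup_\alpha s(h(\alpha))=1$, and the range of $\alpha\mapsto s(h(\alpha))$ over $\alpha\in\mathbb{R}$ is $[0,1)$.
   Context: Let $G=(V,E)$ be an undirected connected graph with $n$ nodes, adjacency matrix $A\in\{0,1\}^{n\times n}$ and diagonal degree matrix $D$, $D_{ii}=\sum_jA_{ij}$. Put $\tilde A=A+I$, $\tilde D=D+I$, and $\mathbf G=\tilde D^{-1/2}\tilde A\tilde D^{-1/2}$. The eigenspace $\mathcal M$ of $\mathbf G$ for its largest eigenvalue $1$ is one-dimensional, spanned by the unit vector $e=\tilde D^{1/2}u_n/\|\tilde D^{1/2}u_n\|$ with $u_n=(1,\dots,1)^\top\in\mathbb{R}^n$. For $z\in\mathbb{R}^n$ write $z_{\mathcal M}=\langle z,e\rangle e$ and $z_{\mathcal M^\perp}=z-z_{\mathcal M}$. The normalized smoothness of $z$ is $s(z):=\|z_{\mathcal M}\|/\|z\|$ (Euclidean norms), with the convention $s(0)=1$. *)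

theory Defs
  imports
    "Graph_Theory.Pair_Digraph"
    "Graph_Theory.Digraph_Component"
    "HOL-Analysis.Analysis"
begin

text \<open>
  An undirected graph is a \<open>pair_pseudo_graph\<close> of Graph_Theory: a finite set of nodes with a symmetric
  set of arcs. Loops are not excluded; simple graphs are the special case without them. The node
  set is the whole finite type \<open>'n\<close>, so that vectors and matrices are indexed by the nodes.
\<close>

definition adj_matrix :: "'n::finite pair_pre_digraph \<Rightarrow> real^'n^'n" where
  "adj_matrix G = (\<chi> i j. if (i, j) \<in> parcs G then 1 else 0)"

definition deg_matrix :: "'n::finite pair_pre_digraph \<Rightarrow> real^'n^'n" where
  "deg_matrix G = (\<chi> i j. if i = j then (\<Sum>k\<in>UNIV. adj_matrix G $ i $ k) else 0)"

definition adj_aug :: "'n::finite pair_pre_digraph \<Rightarrow> real^'n^'n" where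
  "adj_aug G = adj_matrix G + mat 1"

definition deg_aug :: "'n::finite pair_pre_digraph \<Rightarrow> real^'n^'n" where
  "deg_aug G = deg_matrix G + mat 1"

text \<open>The real power of a diagonal matrix with positive diagonal; off-diagonal entries of the
  argument are ignored.\<close>

definition diag_powr :: "real^'n^'n \<Rightarrow> real \<Rightarrow> real^'n^'n" where
  "diag_powr M p = (\<chi> i j. if i = j then (M $ i $ i) powr p else 0)"

definition prop_matrix :: "'n::finite pair_pre_digraph \<Rightarrow> real^'n^'n" where
  "prop_matrix G = diag_powr (deg_aug G) (- 1/2) ** adj_aug G ** diag_powr (deg_aug G) (- 1/2)"

definition eigvec :: "'n::finite pair_pre_digraph \<Rightarrow> real^'n" where
  "eigvec G = (let w = diag_powr (deg_aug G) (1/2) *v (\<chi> i. 1) in (1 / norm w) *\<^sub>R w)"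

definition proj_M :: "'n::finite pair_pre_digraph \<Rightarrow> real^'n \<Rightarrow> real^'n" where
  "proj_M G z = (z \<bullet> eigvec G) *\<^sub>R eigvec G"

definition proj_M_perp :: "'n::finite pair_pre_digraph \<Rightarrow> real^'n \<Rightarrow> real^'n" where
  "proj_M_perp G z = z - proj_M G z"

definition smoothness :: "'n::finite pair_pre_digraph \<Rightarrow> real^'n \<Rightarrow> real" where
  "smoothness G z = (if z = 0 then 1 else norm (proj_M G z) / norm z)"

definition leaky_relu :: "real \<Rightarrow> real^'n \<Rightarrow> real^'n" where
  "leaky_relu a x = (\<chi> i. max (x $ i) (a * x $ i))"

text \<open>
  The remaining lemmas justify the name \<open>proj_M\<close>: for a connected graph, 1 is the largest
  eigenvalue of \<open>prop_matrix G\<close>, and its eigenspace is the line spanned by the unit vector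
  \<open>eigvec G\<close>.
\<close>

lemma adj_aug_nth: "adj_aug G $ i $ j = (if (i, j) \<in> parcs G then 1 else 0) + (if i = j then 1 else 0)"
  by (simp add: adj_aug_def adj_matrix_def mat_def)

lemma deg_aug_nth: "deg_aug G $ i $ i = (\<Sum>j\<in>UNIV. adj_aug G $ i $ j)"
  by (simp add: deg_aug_def deg_matrix_def adj_aug_def mat_def sum.distrib)

lemma deg_aug_pos: "deg_aug G $ i $ i > 0"
  by (simp add: deg_aug_def deg_matrix_def mat_def adj_matrix_def add_nonneg_pos sum_nonneg)

lemma diag_powr_mult_nth: "(diag_powr M p *v x) $ i = (M $ i $ i) powr p * x $ i"
proof -
  have "(diag_powr M p *v x) $ i = (\<Sum>j\<in>UNIV. if i = j then (M $ i $ i) powr p * x $ j else 0)"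
    unfolding matrix_vector_mult_def diag_powr_def vec_lambda_beta by (intro sum.cong) auto
  then show ?thesis by simp
qed

lemma eigvec_raw_nth: "(diag_powr (deg_aug G) (1/2) *v (\<chi> i. 1)) $ i = sqrt (deg_aug G $ i $ i)"
  using deg_aug_pos[of G i] by (simp add: diag_powr_mult_nth powr_half_sqrt)

lemma eigvec_raw_nonzero: "diag_powr (deg_aug G) (1/2) *v (\<chi> i. 1) \<noteq> 0"
proof
  assume "diag_powr (deg_aug G) (1/2) *v (\<chi> i. 1) = 0"
  then have "sqrt (deg_aug G $ i $ i) = 0" for i
    using eigvec_raw_nth[of G i] by simp
  moreover have "sqrt (deg_aug G $ undefined $ undefined) > 0" using deg_aug_pos[of G undefined] by simp
  ultimately show False by simp
qed

lemma norm_eigvec: "norm (eigvec G) = 1"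
  using eigvec_raw_nonzero[of G] by (simp add: eigvec_def Let_def)

lemma prop_matrix_eigen_iff:
  "prop_matrix G *v x = c *\<^sub>R x \<longleftrightarrow>
    (\<forall>i. (\<Sum>j\<in>UNIV. adj_aug G $ i $ j * (x $ j / sqrt (deg_aug G $ j $ j)))
        = c * deg_aug G $ i $ i * (x $ i / sqrt (deg_aug G $ i $ i)))"
proof -
  have r: "(deg_aug G $ i $ i) powr (- 1/2) = 1 / sqrt (deg_aug G $ i $ i)" for i
  proof -
    have "(deg_aug G $ i $ i) powr (- (1/2)) = 1 / sqrt (deg_aug G $ i $ i)"
      using deg_aug_pos[of G i] unfolding powr_minus by (simp add: powr_half_sqrt field_simps)
    then show ?thesis by simp
  qed
  have n: "(prop_matrix G *v x) $ i = (1 / sqrt (deg_aug G $ i $ i)) *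
      (\<Sum>j\<in>UNIV. adj_aug G $ i $ j * (x $ j / sqrt (deg_aug G $ j $ j)))" for i
  proof -
    have "prop_matrix G *v x = diag_powr (deg_aug G) (- 1/2) *v
        (adj_aug G *v (diag_powr (deg_aug G) (- 1/2) *v x))"
      by (simp add: prop_matrix_def matrix_vector_mul_assoc matrix_mul_assoc)
    then show ?thesis
      by (simp only: diag_powr_mult_nth r matrix_vector_mult_def[of "adj_aug G"] vec_lambda_beta
          times_divide_eq_left mult_1_left)
  qed
  have s: "sqrt (deg_aug G $ i $ i) > 0" "deg_aug G $ i $ i / sqrt (deg_aug G $ i $ i) = sqrt (deg_aug G $ i $ i)" for i
    using deg_aug_pos[of G i] by (simp_all add: real_div_sqrt)
  have "(1 / sqrt (deg_aug G $ i $ i)) * S = c * x $ i \<longleftrightarrow>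
      S = c * deg_aug G $ i $ i * (x $ i / sqrt (deg_aug G $ i $ i))" for i S
  proof -
    have "c * deg_aug G $ i $ i * (x $ i / sqrt (deg_aug G $ i $ i))
        = c * x $ i * (deg_aug G $ i $ i / sqrt (deg_aug G $ i $ i))"
      by simp
    also have "\<dots> = c * x $ i * sqrt (deg_aug G $ i $ i)"
      by (simp only: s(2))
    finally have eq: "c * deg_aug G $ i $ i * (x $ i / sqrt (deg_aug G $ i $ i)) = c * x $ i * sqrt (deg_aug G $ i $ i)" .
    have "(1 / sqrt (deg_aug G $ i $ i)) * S = c * x $ i \<longleftrightarrow> S = c * x $ i * sqrt (deg_aug G $ i $ i)"
      using s(1)[of i] by (simp only: times_divide_eq_left mult_1_left) (simp add: divide_eq_eq)
    then show ?thesis by (simp only: eq)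
  qed
  then show ?thesis by (simp only: vec_eq_iff n vector_scaleR_component real_scaleR_def)
qed

lemma prop_matrix_eigenvalue_le_1:
  assumes "prop_matrix G *v x = c *\<^sub>R x" "x \<noteq> 0"
  shows "c \<le> 1"
proof -
  define y where "y j = x $ j / sqrt (deg_aug G $ j $ j)" for j
  obtain i where i: "\<And>j. \<bar>y j\<bar> \<le> \<bar>y i\<bar>"
  proof -
    have "Max (range (\<lambda>j. \<bar>y j\<bar>)) \<in> range (\<lambda>j. \<bar>y j\<bar>)" by (intro Max_in) auto
    then obtain i where "Max (range (\<lambda>j. \<bar>y j\<bar>)) = \<bar>y i\<bar>" by (elim rangeE)
    moreover have "\<bar>y j\<bar> \<le> Max (range (\<lambda>j. \<bar>y j\<bar>))" for j by (intro Max_ge) auto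
    ultimately show ?thesis using that by metis
  qed
  from \<open>x \<noteq> 0\<close> obtain k where "x $ k \<noteq> 0" by (auto simp: vec_eq_iff)
  then have "y k \<noteq> 0" using deg_aug_pos[of G k] by (simp add: y_def)
  with i[of k] have p: "\<bar>y i\<bar> > 0" by linarith
  have "c * deg_aug G $ i $ i * y i = (\<Sum>j\<in>UNIV. adj_aug G $ i $ j * y j)"
    using assms(1) unfolding prop_matrix_eigen_iff y_def by simp
  then have "\<bar>c\<bar> * deg_aug G $ i $ i * \<bar>y i\<bar> = \<bar>\<Sum>j\<in>UNIV. adj_aug G $ i $ j * y j\<bar>"
    by (metis abs_mult abs_of_pos[OF deg_aug_pos[of G i]])
  also have "\<dots> \<le> (\<Sum>j\<in>UNIV. adj_aug G $ i $ j * \<bar>y i\<bar>)"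
    by (rule order_trans[OF sum_abs], rule sum_mono) (auto simp: abs_mult adj_aug_nth i)
  also have "\<dots> = deg_aug G $ i $ i * \<bar>y i\<bar>"
    by (simp add: deg_aug_nth sum_distrib_right)
  finally have "\<bar>c\<bar> * (deg_aug G $ i $ i * \<bar>y i\<bar>) \<le> 1 * (deg_aug G $ i $ i * \<bar>y i\<bar>)" by (simp add: mult.assoc)
  moreover have "deg_aug G $ i $ i * \<bar>y i\<bar> > 0" using p deg_aug_pos[of G i] by simp
  ultimately have "\<bar>c\<bar> \<le> 1" by (rule mult_right_le_imp_le)
  then show ?thesis by linarith
qed

lemma eigenspace_eq_span_eigvec:
  fixes G :: "'n::finite pair_pre_digraph"
  assumes "pair_pseudo_graph G" "pverts G = UNIV" "Digraph_Component.connected (with_proj G)"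
  shows "{x. prop_matrix G *v x = x} = span {eigvec G}"
proof -
  define w where "w = diag_powr (deg_aug G) (1/2) *v (\<chi> i. 1)"
  have sw: "span {eigvec G} = range (\<lambda>k. k *\<^sub>R w)"
  proof -
    have "eigvec G = (1 / norm w) *\<^sub>R w" "norm w \<noteq> 0"
      using eigvec_raw_nonzero[of G] by (simp_all add: eigvec_def w_def Let_def)
    then have "k *\<^sub>R eigvec G = (k / norm w) *\<^sub>R w" "k *\<^sub>R w = (k * norm w) *\<^sub>R eigvec G" for k
      by simp_all
    then show ?thesis unfolding span_singleton by blast
  qed
  have fixed: "prop_matrix G *v x = x \<longleftrightarrow> (\<exists>k. x = k *\<^sub>R w)" for x
  proof
    assume "\<exists>k. x = k *\<^sub>R w"
    then obtain k where "x = k *\<^sub>R w" by blast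
    then have "x $ i / sqrt (deg_aug G $ i $ i) = k" for i
      using eigvec_raw_nth[of G i] deg_aug_pos[of G i] by (simp add: w_def)
    then have "prop_matrix G *v x = 1 *\<^sub>R x"
      unfolding prop_matrix_eigen_iff by (simp add: deg_aug_nth sum_distrib_right)
    then show "prop_matrix G *v x = x" by simp
  next
    assume "prop_matrix G *v x = x"
    define y where "y j = x $ j / sqrt (deg_aug G $ j $ j)" for j
    have eq: "(\<Sum>j\<in>UNIV. adj_aug G $ i $ j * y j) = deg_aug G $ i $ i * y i" for i
      using \<open>prop_matrix G *v x = x\<close> prop_matrix_eigen_iff[of G x 1] by (simp add: y_def)
    obtain m where m: "\<And>j. y j \<le> y m"
    proof -
      have "Max (range y) \<in> range y" by (intro Max_in) auto
      then obtain i where "Max (range y) = y i" by (elim rangeE)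
      moreover have "y j \<le> Max (range y)" for j by (intro Max_ge) auto
      ultimately show ?thesis using that by metis
    qed
    have step: "y j = y m" if "y i = y m" "(i, j) \<in> parcs G" for i j
    proof -
      have "(\<Sum>k\<in>UNIV. adj_aug G $ i $ k * (y m - y k)) = 0"
        using eq[of i] that(1) by (simp add: right_diff_distrib sum_subtractf sum_distrib_right deg_aug_nth)
      moreover have "\<And>k. adj_aug G $ i $ k * (y m - y k) \<ge> 0"
        using m by (simp add: adj_aug_nth)
      ultimately have "adj_aug G $ i $ j * (y m - y j) = 0"
        by (simp add: sum_nonneg_eq_0_iff)
      moreover have "adj_aug G $ i $ j > 0" using that(2) by (simp add: adj_aug_nth)
      ultimately show ?thesis by simp
    qed
    interpret pair_pseudo_graph G by fact
    have sym: "(j, i) \<in> parcs G" if "(i, j) \<in> parcs G" for i j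
      using pair_sym_arcs that by (auto simp: symmetric_def sym_def)
    have y: "y j = y m" for j
    proof -
      have "m \<rightarrow>\<^sup>*\<^bsub>with_proj (mk_symmetric (with_proj G))\<^esub> j"
        using assms(2,3) by (auto simp: Digraph_Component.connected_def strongly_connected_def mk_symmetric_def)
      then have "(m, j) \<in> (parcs (mk_symmetric (with_proj G)))\<^sup>*"
        unfolding reachable_def with_proj_simps by (rule rtrancl_on_rtranclI)
      then show ?thesis
      proof (induction rule: rtrancl_induct)
        case (step u v)
        then have "(u, v) \<in> parcs G" by (auto simp: mk_symmetric_def sym)
        with step \<open>\<And>i j. y i = y m \<Longrightarrow> (i, j) \<in> parcs G \<Longrightarrow> y j = y m\<close> show ?case by blast
      qed simp
    qed
    have "x $ i = y m * sqrt (deg_aug G $ i $ i)" for i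
      using y[of i] deg_aug_pos[of G i] by (simp add: y_def[of i] divide_simps)
    then have "x = y m *\<^sub>R w" by (simp add: vec_eq_iff w_def eigvec_raw_nth)
    then show "\<exists>k. x = k *\<^sub>R w" by blast
  qed
  show ?thesis unfolding sw using fixed by auto
qed

end

theory Submission
  imports Defs
begin

text \<open>
  The entries of \<open>e\<close> are positive. Hence \<open>h \<alpha>\<close> has only negative entries for large \<open>\<alpha>\<close> and only
  positive ones for very negative \<open>\<alpha>\<close>, and \<open>\<langle>h \<alpha>, e\<rangle>\<close> changes sign, which gives smoothness 0. For
  very negative \<open>\<alpha>\<close> leaky ReLU acts as the identity, so that \<open>h \<alpha> = z - \<alpha> e\<close> has a bounded
  component orthogonal to \<open>e\<close> and an unbounded one along \<open>e\<close>: the smoothness comes arbitrarily close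
  to 1. It never equals 1, because leaky ReLU is injective and preserves the line spanned by \<open>e\<close>
  in both directions. Continuity in \<open>\<alpha>\<close> fills the interval.
\<close>

lemma eigvec_pos: "eigvec G $ i > 0"
proof -
  have "norm (diag_powr (deg_aug G) (1/2) *v (\<chi> i. 1)) > 0"
    using eigvec_raw_nonzero[of G] by simp
  then show ?thesis
    using deg_aug_pos[of G i] by (simp add: eigvec_def Let_def eigvec_raw_nth)
qed

lemma smoothness_eq:
  "smoothness G x = (if x = 0 then 1 else \<bar>x \<bullet> eigvec G\<bar> / norm x)"
  by (simp add: smoothness_def proj_M_def norm_eigvec)

lemma smoothness_nonneg: "0 \<le> smoothness G x"
  by (simp add: smoothness_eq)

lemma smoothness_le_1: "smoothness G x \<le> 1"
  using Cauchy_Schwarz_ineq2[of x "eigvec G"]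
  by (auto simp: smoothness_eq norm_eigvec divide_le_eq)

text \<open>Equality case of Cauchy-Schwarz, \<open>eigvec G\<close> being a unit vector. The zero
  vector, of smoothness 1 by convention, is covered by \<open>k = 0\<close>.\<close>

lemma smoothness_eq_1_imp_collinear:
  assumes "smoothness G x = 1"
  obtains k where "x = k *\<^sub>R eigvec G"
proof (cases "x = 0")
  case True
  then show ?thesis using that[of 0] by simp
next
  case False
  with assms have eq: "\<bar>x \<bullet> eigvec G\<bar> = norm x"
    by (simp add: smoothness_eq)
  have "norm x *\<^sub>R eigvec G = x \<or> norm x *\<^sub>R eigvec G = - x"
    using eq norm_cauchy_schwarz_abs_eq[of x "eigvec G"] by (simp add: norm_eigvec)
  then have "x = norm x *\<^sub>R eigvec G \<or> x = (- norm x) *\<^sub>R eigvec G"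
    by (auto simp: minus_equation_iff)
  then show ?thesis using that by blast
qed

lemma proj_M_perp_scaleR_eigvec: "proj_M_perp G (k *\<^sub>R eigvec G) = 0"
  by (simp add: proj_M_perp_def proj_M_def dot_square_norm norm_eigvec)

lemma leaky_relu_nonneg:
  assumes "a \<le> 1" "\<And>i. 0 \<le> x $ i"
  shows "leaky_relu a x = x"
proof -
  have "a * x $ i \<le> x $ i" for i
    using mult_right_mono[OF assms(1) assms(2)[of i]] by simp
  then show ?thesis by (simp add: leaky_relu_def vec_eq_iff)
qed

lemma leaky_relu_nonpos:
  assumes "a \<le> 1" "\<And>i. x $ i \<le> 0"
  shows "leaky_relu a x = a *\<^sub>R x"
proof -
  have "x $ i \<le> a * x $ i" for i
    using mult_right_mono_neg[OF assms(1) assms(2)[of i]] by simp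
  then show ?thesis by (simp add: leaky_relu_def vec_eq_iff)
qed

lemma leaky_relu_inject:
  assumes "0 < a"
  shows "leaky_relu a x = leaky_relu a y \<longleftrightarrow> x = y"
proof -
  have "strict_mono (\<lambda>t. max t (a * t))"
  proof (rule strict_monoI)
    fix s t :: real
    assume "s < t"
    moreover from this have "a * s < a * t" using assms by simp
    ultimately show "max s (a * s) < max t (a * t)" by linarith
  qed
  from strict_mono_eq[OF this] show ?thesis
    by (simp add: leaky_relu_def vec_eq_iff)
qed

text \<open>As the entries of \<open>eigvec G\<close> share one sign, a preimage on the line can be
  written down: factor \<open>k\<close> if \<open>k\<close> is nonnegative, \<open>k / a\<close>
  otherwise. Injectivity excludes any other preimage.\<close>

lemma leaky_relu_eq_scaleR_eigvec:
  assumes "0 < a" "a \<le> 1" "leaky_relu a x = k *\<^sub>R eigvec G"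
  obtains k' where "x = k' *\<^sub>R eigvec G"
proof (cases "0 \<le> k")
  case True
  then have "leaky_relu a (k *\<^sub>R eigvec G) = k *\<^sub>R eigvec G"
    using assms(2) eigvec_pos[of G] by (intro leaky_relu_nonneg) (auto simp: less_imp_le)
  then show ?thesis using that assms leaky_relu_inject by metis
next
  case False
  then have "leaky_relu a ((k / a) *\<^sub>R eigvec G) = a *\<^sub>R ((k / a) *\<^sub>R eigvec G)"
    using assms(1,2) eigvec_pos[of G]
    by (intro leaky_relu_nonpos) (auto simp: less_imp_le divide_le_0_iff mult_le_0_iff)
  also have "\<dots> = k *\<^sub>R eigvec G" using assms(1) by simp
  finally show ?thesis using that assms leaky_relu_inject by metis
qed

lemma continuous_on_leaky_relu [continuous_intros]:
  "continuous_on S f \<Longrightarrow> continuous_on S (\<lambda>t. leaky_relu a (f t))"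
  unfolding leaky_relu_def by (intro continuous_intros continuous_on_max)

text \<open>Shifting \<open>z\<close> by \<open>B\<close> times \<open>eigvec G\<close> in either
  direction gives all entries one sign, so that leaky ReLU becomes linear there.\<close>

lemma eigvec_shift_bound:
  obtains B where "B \<ge> 0" "\<And>i. \<bar>z $ i\<bar> \<le> B * eigvec G $ i"
proof
  \<comment> \<open>The sum of the nonnegative ratios dominates each of them.\<close>
  define B where "B = (\<Sum>i\<in>UNIV. \<bar>z $ i\<bar> / eigvec G $ i)"
  have nonneg: "0 \<le> \<bar>z $ i\<bar> / eigvec G $ i" for i
    using eigvec_pos[of G i] by simp
  then show "B \<ge> 0" unfolding B_def by (intro sum_nonneg) blast
  show "\<bar>z $ i\<bar> \<le> B * eigvec G $ i" for i
  proof -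
    have "\<bar>z $ i\<bar> / eigvec G $ i \<le> B"
      unfolding B_def using nonneg by (intro member_le_sum) auto
    then show ?thesis using eigvec_pos[of G i] by (simp add: divide_le_eq)
  qed
qed

context
  fixes G :: "'n::finite pair_pre_digraph" and a :: real and z :: "real^'n"
    and f :: "real \<Rightarrow> real"
  assumes a: "0 < a" "a < 1"
    and z: "proj_M_perp G z \<noteq> 0"
  defines "f \<equiv> \<lambda>\<alpha>. smoothness G (leaky_relu a (z - \<alpha> *\<^sub>R eigvec G))"
begin

text \<open>Otherwise \<open>z\<close> itself would lie on the line of \<open>eigvec G\<close>,
  against the assumption on \<open>proj_M_perp G z\<close>. The case \<open>k = 0\<close> keeps the
  default value of the smoothness at 0 out of play.\<close>

lemma shifted_relu_not_collinear: "leaky_relu a (z - \<alpha> *\<^sub>R eigvec G) \<noteq> k *\<^sub>R eigvec G"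
proof
  assume "leaky_relu a (z - \<alpha> *\<^sub>R eigvec G) = k *\<^sub>R eigvec G"
  then obtain k' where "z - \<alpha> *\<^sub>R eigvec G = k' *\<^sub>R eigvec G"
    using leaky_relu_eq_scaleR_eigvec a by (metis less_imp_le)
  then have "z = (k' + \<alpha>) *\<^sub>R eigvec G" by (simp add: algebra_simps)
  then show False using z proj_M_perp_scaleR_eigvec by metis
qed

lemma shifted_relu_nonzero: "leaky_relu a (z - \<alpha> *\<^sub>R eigvec G) \<noteq> 0"
  using shifted_relu_not_collinear[of \<alpha> 0] by simp

lemma smoothness_shifted_less_1: "f \<alpha> < 1"
  using smoothness_le_1 smoothness_eq_1_imp_collinear shifted_relu_not_collinear
  unfolding f_def by (metis order_le_less)

lemma continuous_smoothness_shifted: "continuous_on UNIV f"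
  unfolding f_def smoothness_eq if_not_P[OF shifted_relu_nonzero]
  by (intro continuous_intros) (simp add: shifted_relu_nonzero)

lemma smoothness_shifted_attains_0: "\<exists>\<alpha>. f \<alpha> = 0"
proof -
  define g where "g \<alpha> = leaky_relu a (z - \<alpha> *\<^sub>R eigvec G) \<bullet> eigvec G" for \<alpha>
  obtain B where B: "B \<ge> 0" "\<And>i. \<bar>z $ i\<bar> \<le> B * eigvec G $ i"
    using eigvec_shift_bound by blast
  have e: "0 \<le> eigvec G $ i" for i
    using eigvec_pos[of G i] by simp
  have pos: "0 \<le> (z - (- B) *\<^sub>R eigvec G) $ i" for i
    using B(2)[of i] by simp
  have neg: "(z - B *\<^sub>R eigvec G) $ i \<le> 0" for i
    using B(2)[of i] by simp
  have "g B \<le> 0"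
    unfolding g_def leaky_relu_nonpos[OF less_imp_le[OF a(2)] neg] inner_vec_def
    using a neg e by (intro sum_nonpos) (simp add: mult_nonpos_nonneg mult_nonneg_nonpos)
  moreover have "0 \<le> g (- B)"
    unfolding g_def leaky_relu_nonneg[OF less_imp_le[OF a(2)] pos] inner_vec_def
    using pos e by (intro sum_nonneg) simp
  moreover have "continuous_on {- B..B} g"
    unfolding g_def by (intro continuous_intros)
  \<comment> \<open>The signs at the ends are reversed, \<open>g B \<le> 0 \<le> g (- B)\<close>,
    hence the decreasing form of the intermediate value theorem.\<close>
  ultimately obtain \<alpha> where "g \<alpha> = 0"
    using IVT2'[of g B 0 "- B"] B(1) by auto
  then show ?thesis
    unfolding f_def smoothness_eq g_def using shifted_relu_nonzero by auto
qed

text \<open>At shift \<open>p - t\<close> with \<open>t\<close> large the component along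
  \<open>eigvec G\<close> is \<open>t\<close> and the orthogonal one still has norm
  \<open>q\<close>, so the smoothness is at least \<open>t / (q + t)\<close>.\<close>

lemma smoothness_shifted_near_1:
  assumes "c < 1"
  obtains \<alpha> where "c < f \<alpha>"
proof -
  define p where "p = z \<bullet> eigvec G"
  define q where "q = norm (proj_M_perp G z)"
  obtain B where B: "B \<ge> 0" "\<And>i. \<bar>z $ i\<bar> \<le> B * eigvec G $ i"
    using eigvec_shift_bound by blast
  \<comment> \<open>The first two terms make the shifted vector entrywise nonnegative, the 1 gives
    strictness, and the last term yields \<open>c < t / (q + t)\<close>; \<open>c\<close> may be
    negative, hence its absolute value.\<close>
  define t where "t = \<bar>p\<bar> + B + 1 + \<bar>c\<bar> * q / (1 - c)"
  have q: "0 \<le> q" by (simp add: q_def)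
  have t: "B + p \<le> t" "0 < t" "c * q < t * (1 - c)"
  proof -
    have "0 \<le> \<bar>c\<bar> * q / (1 - c)" using assms q by simp
    then show "B + p \<le> t" "0 < t" using B(1) by (auto simp: t_def)
    have "c * q \<le> \<bar>c\<bar> * q" using q by (simp add: mult_right_mono)
    also have "\<dots> = (\<bar>c\<bar> * q / (1 - c)) * (1 - c)" using assms by simp
    also have "\<dots> < t * (1 - c)"
      using assms B(1) by (intro mult_strict_right_mono) (auto simp: t_def)
    finally show "c * q < t * (1 - c)" .
  qed
  define x where "x = z - (p - t) *\<^sub>R eigvec G"
  have "0 \<le> x $ i" for i
  proof -
    have "B * eigvec G $ i \<le> (t - p) * eigvec G $ i"
      using t(1) eigvec_pos[of G i] by (intro mult_right_mono) auto
    then show ?thesis using B(2)[of i] by (simp add: x_def algebra_simps)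
  qed
  then have h: "leaky_relu a x = x" using a by (intro leaky_relu_nonneg) auto
  then have "x \<noteq> 0" using shifted_relu_nonzero[of "p - t"] by (simp add: x_def)
  have "x = proj_M_perp G z + t *\<^sub>R eigvec G"
    by (simp add: x_def proj_M_perp_def proj_M_def p_def algebra_simps)
  then have "norm x \<le> q + t"
    using norm_triangle_ineq[of "proj_M_perp G z" "t *\<^sub>R eigvec G"] t(2)
    by (simp add: q_def norm_eigvec)
  have "x \<bullet> eigvec G = t"
    by (simp add: x_def inner_diff_left p_def dot_square_norm norm_eigvec)
  then have "f (p - t) = t / norm x"
    using h \<open>x \<noteq> 0\<close> t(2) by (simp add: f_def flip: x_def) (simp add: smoothness_eq)
  moreover have "c < t / norm x"
  proof -
    have "c < t / (q + t)"
      using t(2,3) q by (simp add: pos_less_divide_eq add_nonneg_pos algebra_simps)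
    also have "\<dots> \<le> t / norm x"
      using \<open>x \<noteq> 0\<close> \<open>norm x \<le> q + t\<close> t(2) q by (intro divide_left_mono) (auto simp: add_nonneg_pos)
    finally show ?thesis .
  qed
  ultimately show ?thesis using that[of "p - t"] by simp
qed

lemma range_smoothness_shifted: "range f = {0..<1}"
proof
  show "range f \<subseteq> {0..<1}"
    using smoothness_shifted_less_1 smoothness_nonneg by (auto simp: f_def)
  show "{0..<1} \<subseteq> range f"
  proof
    fix y :: real
    assume "y \<in> {0..<1}"
    then obtain \<beta> where \<beta>: "0 \<le> y" "y < f \<beta>"
      using smoothness_shifted_near_1[of y] by auto
    \<comment> \<open>Connectedness of a subset of the real line, not of a graph.\<close>
    have "Topological_Spaces.connected (range f)"
      using continuous_smoothness_shifted by (intro connected_continuous_image) auto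
    moreover have "0 \<in> range f"
      using smoothness_shifted_attains_0 by (metis rangeI)
    ultimately show "y \<in> range f"
      using connectedD_interval[of "range f" 0 "f \<beta>" y] \<beta> by auto
  qed
qed

end

theorem proposition4p4:
  fixes G :: "'n::finite pair_pre_digraph" and a :: real and z :: "real^'n"
    and zs h :: "real \<Rightarrow> real^'n"
  assumes "pair_pseudo_graph G" and "pverts G = UNIV"
    and "Digraph_Component.connected (with_proj G)"
    and "0 < a" and "a < 1"
    and "proj_M_perp G z \<noteq> 0"
    and "\<And>\<alpha>. zs \<alpha> = z - \<alpha> *\<^sub>R eigvec G"
    and "\<And>\<alpha>. h \<alpha> = leaky_relu a (zs \<alpha>)"
  shows "((\<exists>\<alpha>. smoothness G (h \<alpha>) = 0) \<and> (\<forall>\<alpha>. 0 \<le> smoothness G (h \<alpha>))) \<and>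
    (SUP \<alpha>. smoothness G (h \<alpha>)) = 1 \<and>
    range (\<lambda>\<alpha>. smoothness G (h \<alpha>)) = {0..<1}"
proof -
  have h: "h \<alpha> = leaky_relu a (z - \<alpha> *\<^sub>R eigvec G)" for \<alpha>
    by (simp add: assms(7,8))
  have range: "range (\<lambda>\<alpha>. smoothness G (h \<alpha>)) = {0..<1}"
    unfolding h by (rule range_smoothness_shifted[OF assms(4-6)])
  have "\<exists>\<alpha>. smoothness G (h \<alpha>) = 0"
    unfolding h by (rule smoothness_shifted_attains_0[OF assms(4-6)])
  \<comment> \<open>The supremum is the right end of the half-open interval, which is not
    attained.\<close>
  then show ?thesis
    unfolding range by (simp add: smoothness_nonneg cSup_atLeastLessThan)
qed

end
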